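(* Let $F:\Delta\to\mathbb R^n$ be smooth. For $(\sigma,\mu)\in\Delta\times\mathbb R^n$, $${\rm gap}(\sigma)=\mathbf 1^\top\check\mu(\sigma)=\mathbf 1^\top\mu-\min_i\left((G(\sigma,\mu)+\mu)/\sigma\right)_i .$$ Consequently, for $\sigma^\star\in\Delta$, the following statements are equivalent. (i) $\sigma^\star$ is a solution of ${\rm VI}(F,\Delta)$. (ii) $\sigma^\star$ is a zero of $\check\mu$, i.e. $\check\mu(\sigma^\star)=\mathbf 0$. (iii) $(\sigma^\star,\mathbf 0)$ is a limit point of $E\cap(\Delta\times\{\mu\in\mathbb R^n:\mu>0\})$.
   Context: $\Delta=\{\sigma\in\mathbb R^n:\sigma\ge0,\ \mathbf 1^\top\sigma=1\}$, $\mathbf 1$ is the all-ones vector; $\circ$, $/$ and vector inequalities are componentwise. A solution of ${\rm VI}(F,\Delta)$ is $\sigma^\star\in\Delta$ with $\langle F(\sigma^\star),\sigma'-\sigma^\star\rangle\ge0$ for all $\sigma'\in\Delta$. The gap function is ${\rm gap}(\sigma)=\sup_{\sigma'\in\Delta}\langle F(\sigma),\sigma-\sigma'\rangle$. $G(\sigma,\mu)=(I-\sigma\mathbf 1^\top)(\sigma\circ F(\sigma)-\mu)$ for $(\sigma,\mu)\in\Delta\times\mathbb R^n$. The fixed-point bundle is $E=\{(\sigma,\mu)\in\Delta\times\mathbb R^n:G(\sigma,\mu)=0\}=\bigcup_{\sigma\in\Delta}\{\sigma\}\times\{\sigma\circ F(\sigma)+v\sigma:v\in\mathbb R\}$. The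 nonnegative section is $\check\mu(\sigma)=\sigma\circ\left(F(\sigma)-(\min_iF_i(\sigma))\mathbf 1\right)$. Convention for the quotient: identically $G(\sigma,\mu)+\mu=\sigma\circ\left(F(\sigma)-(\sigma^\top F(\sigma)-\mathbf 1^\top\mu)\mathbf 1\right)$, and for components with $\sigma_i=0$ the quotient $((G(\sigma,\mu)+\mu)/\sigma)_i$ is understood as the value $F_i(\sigma)-\sigma^\top F(\sigma)+\mathbf 1^\top\mu$ obtained by cancelling $\sigma_i$. *)

theory Defs
  imports "HOL-Analysis.Analysis"
begin

text \<open>
  The vectors are of type \<^typ>\<open>real ^ 'n\<close>.  On this type the library's \<open>*\<close> is the componentwise
  product, \<open>1\<close> is the all-ones vector and \<open>\<le>\<close> is the componentwise order.  The library's \<open><\<close>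
  is not componentwise, so strict positivity is written out with components.
\<close>

definition unit_simplex :: "(real ^ 'n) set" where
  "unit_simplex = {\<sigma>. 0 \<le> \<sigma> \<and> 1 \<bullet> \<sigma> = 1}"

text \<open>
  On an open set, \<open>Ck_on k f U\<close> says that \<open>f\<close> is \<open>k\<close> times differentiable with all
  iterated directional derivatives up to order \<open>k\<close> continuous, i.e. of class \<open>C^k\<close>.
\<close>

primrec Ck_on ::
  "nat \<Rightarrow> ('a::real_normed_vector \<Rightarrow> 'b::real_normed_vector) \<Rightarrow> 'a set \<Rightarrow> bool" where
  "Ck_on 0 f U \<longleftrightarrow> continuous_on U f"
| "Ck_on (Suc k) f U \<longleftrightarrow>
     (\<forall>x\<in>U. f differentiable at x) \<and> (\<forall>v. Ck_on k (\<lambda>x. frechet_derivative f (at x) v) U)"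

text \<open>
  The simplex has empty interior, so smoothness on it is meant in the usual sense for
  arbitrary subsets: around each point there is an ambient smooth extension.
\<close>

definition smooth_map_on ::
  "('a::real_normed_vector \<Rightarrow> 'b::real_normed_vector) \<Rightarrow> 'a set \<Rightarrow> bool" where
  "smooth_map_on f S \<longleftrightarrow>
     (\<forall>x\<in>S. \<exists>U g. open U \<and> x \<in> U \<and> (\<forall>k. Ck_on k g U) \<and> (\<forall>y\<in>S \<inter> U. g y = f y))"

definition VI_solution :: "('a::real_inner \<Rightarrow> 'a) \<Rightarrow> 'a set \<Rightarrow> 'a \<Rightarrow> bool" where
  "VI_solution F S \<sigma> \<longleftrightarrow> \<sigma> \<in> S \<and> (\<forall>\<sigma>'\<in>S. F \<sigma> \<bullet> (\<sigma>' - \<sigma>) \<ge> 0)"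

text \<open>
  The supremum below is over a nonempty compact set of reals, so the conditionally
  complete \<open>SUP\<close> of the reals is the true supremum.
\<close>

definition gap :: "(real ^ 'n \<Rightarrow> real ^ 'n) \<Rightarrow> real ^ 'n \<Rightarrow> real" where
  "gap F \<sigma> = (SUP \<sigma>'\<in>unit_simplex. F \<sigma> \<bullet> (\<sigma> - \<sigma>'))"

definition G_map :: "(real ^ 'n \<Rightarrow> real ^ 'n) \<Rightarrow> real ^ 'n \<Rightarrow> real ^ 'n \<Rightarrow> real ^ 'n" where
  "G_map F \<sigma> \<mu> =
     (mat 1 - (columnvector \<sigma> :: real ^ 1 ^ 'n) ** (rowvector 1 :: real ^ 'n ^ 1))
       *v (\<sigma> * F \<sigma> - \<mu>)"

definition fp_bundle :: "(real ^ 'n \<Rightarrow> real ^ 'n) \<Rightarrow> ((real ^ 'n) \<times> (real ^ 'n)) set" where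
  "fp_bundle F = {(\<sigma>, \<mu>). \<sigma> \<in> unit_simplex \<and> G_map F \<sigma> \<mu> = 0}"

definition nonneg_section :: "(real ^ 'n \<Rightarrow> real ^ 'n) \<Rightarrow> real ^ 'n \<Rightarrow> real ^ 'n" where
  "nonneg_section F \<sigma> = \<sigma> * (F \<sigma> - (MIN i. F \<sigma> $ i) *\<^sub>R 1)"

text \<open>
  The componentwise quotient \<open>(G(\<sigma>, \<mu>) + \<mu>) / \<sigma>\<close>.  Where \<open>\<sigma>\<close> has a zero component, its value
  is the one obtained by cancelling that component in the identity \<open>G_map_add\<close> below.
\<close>

definition G_quotient :: "(real ^ 'n \<Rightarrow> real ^ 'n) \<Rightarrow> real ^ 'n \<Rightarrow> real ^ 'n \<Rightarrow> real ^ 'n" where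
  "G_quotient F \<sigma> \<mu> =
     (\<chi> i. if \<sigma> $ i \<noteq> 0 then (G_map F \<sigma> \<mu> + \<mu>) $ i / \<sigma> $ i
           else F \<sigma> $ i - \<sigma> \<bullet> F \<sigma> + 1 \<bullet> \<mu>)"

lemma G_map_eq:
  fixes F :: "real ^ 'n \<Rightarrow> real ^ 'n"
  shows "G_map F \<sigma> \<mu> = (\<sigma> * F \<sigma> - \<mu>) - (\<sigma> \<bullet> F \<sigma> - 1 \<bullet> \<mu>) *\<^sub>R \<sigma>"
proof -
  have "((columnvector \<sigma> :: real ^ 1 ^ 'n) ** (rowvector 1 :: real ^ 'n ^ 1)) *v x = (1 \<bullet> x) *\<^sub>R \<sigma>"
    for x :: "real ^ 'n"
    by (simp add: vec_eq_iff matrix_matrix_mult_def matrix_vector_mult_def columnvector_def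
        rowvector_def inner_vec_def sum_distrib_left mult.commute)
  moreover have "1 \<bullet> (\<sigma> * F \<sigma> - \<mu>) = \<sigma> \<bullet> F \<sigma> - 1 \<bullet> \<mu>"
    by (simp add: inner_vec_def sum_subtractf)
  ultimately show ?thesis
    by (simp add: G_map_def matrix_vector_mult_diff_rdistrib)
qed

lemma G_map_add:
  fixes F :: "real ^ 'n \<Rightarrow> real ^ 'n"
  shows "G_map F \<sigma> \<mu> + \<mu> = \<sigma> * (F \<sigma> - (\<sigma> \<bullet> F \<sigma> - 1 \<bullet> \<mu>) *\<^sub>R 1)"
  by (simp add: G_map_eq vec_eq_iff algebra_simps)

lemma fp_bundle_eq:
  fixes F :: "real ^ 'n \<Rightarrow> real ^ 'n"
  shows "fp_bundle F = (\<Union>\<sigma>\<in>unit_simplex. {\<sigma>} \<times> {\<sigma> * F \<sigma> + v *\<^sub>R \<sigma> | v. True})"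
proof -
  have "G_map F \<sigma> \<mu> = 0 \<longleftrightarrow> (\<exists>v. \<mu> = \<sigma> * F \<sigma> + v *\<^sub>R \<sigma>)" if "\<sigma> \<in> unit_simplex" for \<sigma> \<mu>
  proof
    assume "G_map F \<sigma> \<mu> = 0"
    then have "\<mu> = \<sigma> * F \<sigma> + (- (\<sigma> \<bullet> F \<sigma> - 1 \<bullet> \<mu>)) *\<^sub>R \<sigma>"
      by (simp add: G_map_eq algebra_simps)
    then show "\<exists>v. \<mu> = \<sigma> * F \<sigma> + v *\<^sub>R \<sigma>" ..
  next
    assume "\<exists>v. \<mu> = \<sigma> * F \<sigma> + v *\<^sub>R \<sigma>"
    then obtain v where v: "\<mu> = \<sigma> * F \<sigma> + v *\<^sub>R \<sigma>" ..
    have "1 \<bullet> (\<sigma> * F \<sigma>) = \<sigma> \<bullet> F \<sigma>"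
      by (simp add: inner_vec_def)
    then show "G_map F \<sigma> \<mu> = 0"
      using that by (simp add: G_map_eq v unit_simplex_def inner_add_right)
  qed
  then show ?thesis
    by (auto simp: fp_bundle_def)
qed

end

theory Submission
  imports Defs
begin

text \<open>
  A linear function attains its minimum over the simplex at a vertex, so the gap equals
  \<open>\<sigma> \<bullet> F \<sigma> - (MIN i. F \<sigma> $ i)\<close>, and \<open>\<sigma>\<close> solves the variational inequality iff
  \<open>\<sigma> \<bullet> F \<sigma> \<le> F \<sigma> $ j\<close> for every \<open>j\<close>.  A point \<open>(\<tau>, \<tau> * F \<tau> + v *\<^sub>R \<tau>)\<close> of the bundle with
  positive second component satisfies \<open>v > - F \<tau> $ j\<close> for every \<open>j\<close>, so the entries of that
  component sum to more than \<open>\<tau> \<bullet> F \<tau> - F \<tau> $ j\<close>; letting it tend to zero gives the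
  inequality at the limit.  Conversely, a solution is perturbed towards the barycentre, with
  \<open>v\<close> slightly above \<open>- \<sigma> \<bullet> F \<sigma>\<close>.
\<close>

lemma smooth_map_on_imp_continuous_on:
  assumes "smooth_map_on f S"
  shows "continuous_on S f"
  unfolding continuous_on_eq_continuous_within
proof
  fix x assume "x \<in> S"
  then obtain U g where U: "open U" "x \<in> U" "\<And>k. Ck_on k g U" "\<And>y. y \<in> S \<inter> U \<Longrightarrow> g y = f y"
    using assms unfolding smooth_map_on_def by metis
  \<comment> \<open>Class \<open>C^0\<close> is plain continuity of the local extension
    \<open>g\<close>, and \<open>f\<close> agrees with \<open>g\<close> on
    \<open>S \<inter> U\<close>.\<close>
  have "continuous_on U g"
    using U(3)[of 0] by simp
  then have "continuous_on (S \<inter> U) f"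
    using U(4) continuous_on_subset[of U g "S \<inter> U"] continuous_on_cong[of "S \<inter> U" "S \<inter> U" g f]
    by auto
  then have "continuous (at x within S \<inter> U) f"
    using \<open>x \<in> S\<close> U(2) by (simp add: continuous_on_eq_continuous_within)
  \<comment> \<open>Continuity at \<open>x\<close> is local: \<open>U\<close> is an open
    neighbourhood of \<open>x\<close>, so \<open>S \<inter> U\<close> and \<open>S\<close> give the
    same limit filter there.\<close>
  then show "continuous (at x within S) f"
    using at_within_nhd[OF U(2,1), of "S \<inter> U" S] by (auto simp: continuous_within)
qed

lemma mem_unit_simplex_iff: "\<sigma> \<in> unit_simplex \<longleftrightarrow> (\<forall>i. 0 \<le> \<sigma> $ i) \<and> sum (($) \<sigma>) UNIV = 1"
  by (simp add: unit_simplex_def inner_vec_def less_eq_vec_def)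

lemma axis_in_unit_simplex: "axis i 1 \<in> unit_simplex"
  by (simp add: mem_unit_simplex_iff axis_def)

lemma convex_unit_simplex: "convex unit_simplex"
  unfolding convex_alt
  by (auto simp: mem_unit_simplex_iff sum.distrib sum_distrib_left[symmetric])

lemma barycentre_in_unit_simplex: "(\<chi> i::'n::finite. 1 / real CARD('n)) \<in> unit_simplex"
  by (simp add: mem_unit_simplex_iff)

text \<open>The entries of \<sigma> act as weights of an average, and an average is at least any
  lower bound of the averaged values.\<close>

lemma le_inner_unit_simplex:
  assumes "\<sigma> \<in> unit_simplex" "\<And>i. m \<le> x $ i"
  shows "m \<le> x \<bullet> \<sigma>"
proof -
  have "m = (\<Sum>i\<in>UNIV. m * \<sigma> $ i)"
    using assms(1) by (simp add: mem_unit_simplex_iff sum_distrib_left[symmetric])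
  also have "\<dots> \<le> (\<Sum>i\<in>UNIV. x $ i * \<sigma> $ i)"
    using assms by (intro sum_mono mult_right_mono) (auto simp: mem_unit_simplex_iff)
  finally show ?thesis
    by (simp add: inner_vec_def)
qed

lemma VI_solution_unit_simplex_iff:
  assumes "\<sigma> \<in> unit_simplex"
  shows "VI_solution F unit_simplex \<sigma> \<longleftrightarrow> (\<forall>j. \<sigma> \<bullet> F \<sigma> \<le> F \<sigma> $ j)"
proof
  assume "VI_solution F unit_simplex \<sigma>"
  then have "F \<sigma> \<bullet> (axis j 1 - \<sigma>) \<ge> 0" for j
    by (simp add: VI_solution_def axis_in_unit_simplex)
  then show "\<forall>j. \<sigma> \<bullet> F \<sigma> \<le> F \<sigma> $ j"
    by (simp add: inner_diff_right inner_axis inner_commute)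
next
  assume "\<forall>j. \<sigma> \<bullet> F \<sigma> \<le> F \<sigma> $ j"
  then show "VI_solution F unit_simplex \<sigma>"
    using assms le_inner_unit_simplex[of _ "\<sigma> \<bullet> F \<sigma>" "F \<sigma>"]
    by (simp add: VI_solution_def inner_diff_right inner_commute)
qed

lemma gap_eq:
  assumes "\<sigma> \<in> unit_simplex"
  shows "gap F \<sigma> = \<sigma> \<bullet> F \<sigma> - (MIN i. F \<sigma> $ i)"
proof -
  have "(MIN i. F \<sigma> $ i) \<in> range (($) (F \<sigma>))"
    by (rule Min_in) auto
  then obtain k where k: "(MIN i. F \<sigma> $ i) = F \<sigma> $ k"
    by blast
  have "F \<sigma> $ k \<le> F \<sigma> $ i" for i
    unfolding k[symmetric] by simp
  then have "F \<sigma> $ k \<le> F \<sigma> \<bullet> \<sigma>'" if "\<sigma>' \<in> unit_simplex" for \<sigma>'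
    using le_inner_unit_simplex that by blast
  then have "F \<sigma> \<bullet> (\<sigma> - \<sigma>') \<le> \<sigma> \<bullet> F \<sigma> - F \<sigma> $ k" if "\<sigma>' \<in> unit_simplex" for \<sigma>'
    using that by (simp add: inner_diff_right inner_commute[of \<sigma>])
  \<comment> \<open>The bound is attained at the vertex of a minimizing index, so the supremum is a
    maximum.\<close>
  moreover have "\<sigma> \<bullet> F \<sigma> - F \<sigma> $ k = F \<sigma> \<bullet> (\<sigma> - axis k 1)"
    by (simp add: inner_diff_right inner_axis inner_commute)
  ultimately show ?thesis
    unfolding gap_def k
    by (intro cSup_eq_maximum) (use axis_in_unit_simplex in auto)
qed

lemma sum_nonneg_section:
  assumes "\<sigma> \<in> unit_simplex"
  shows "1 \<bullet> nonneg_section F \<sigma> = \<sigma> \<bullet> F \<sigma> - (MIN i. F \<sigma> $ i)"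
proof -
  \<comment> \<open>The weights sum to one, so subtracting any constant \<open>m\<close> from every
    entry of \<open>F \<sigma>\<close> lowers the weighted sum by exactly \<open>m\<close>.\<close>
  have "1 \<bullet> (\<sigma> * (F \<sigma> - m *\<^sub>R 1)) = \<sigma> \<bullet> F \<sigma> - m" for m
    using assms
    by (simp add: inner_vec_def mem_unit_simplex_iff right_diff_distrib sum_subtractf
        mult.commute[of _ m] sum_distrib_left[symmetric])
  then show ?thesis
    by (simp only: nonneg_section_def)
qed

lemma nonneg_section_nonneg:
  assumes "\<sigma> \<in> unit_simplex"
  shows "0 \<le> nonneg_section F \<sigma> $ i"
  using assms by (simp add: nonneg_section_def mem_unit_simplex_iff)

lemma nonneg_section_eq_0_iff:
  assumes "\<sigma> \<in> unit_simplex"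
  shows "nonneg_section F \<sigma> = 0 \<longleftrightarrow> (\<forall>j. \<sigma> \<bullet> F \<sigma> \<le> F \<sigma> $ j)"
proof -
  \<comment> \<open>A vector with nonnegative entries vanishes once its entries sum to at most zero.
    The form with \<open>\<le>\<close> turns into an upper bound on
    \<open>\<sigma> \<bullet> F \<sigma>\<close> by the minimum, hence by every entry.\<close>
  have "nonneg_section F \<sigma> = 0 \<longleftrightarrow> 1 \<bullet> nonneg_section F \<sigma> \<le> 0"
    using nonneg_section_nonneg[OF assms]
    by (auto simp: inner_vec_def vec_eq_iff sum_nonneg sum_nonneg_eq_0_iff antisym_conv)
  also have "\<dots> \<longleftrightarrow> (\<forall>j. \<sigma> \<bullet> F \<sigma> \<le> F \<sigma> $ j)"
    by (simp add: sum_nonneg_section[OF assms])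
  finally show ?thesis .
qed

text \<open>The factor \<open>\<sigma> $ i\<close> cancels in \<open>G_map_add\<close>, so both
  branches of the quotient agree: it is \<open>F \<sigma>\<close> shifted by one constant in all
  entries, and its minimum shifts likewise.\<close>

lemma G_quotient_eq: "G_quotient F \<sigma> \<mu> $ i = F \<sigma> $ i + (1 \<bullet> \<mu> - \<sigma> \<bullet> F \<sigma>)"
  by (simp add: G_quotient_def G_map_add)

lemma Min_G_quotient: "(MIN i. G_quotient F \<sigma> \<mu> $ i) = (MIN i. F \<sigma> $ i) + (1 \<bullet> \<mu> - \<sigma> \<bullet> F \<sigma>)"
  unfolding G_quotient_eq by (rule Min_add_commute) auto

text \<open>The proof gives strict inequality; the weak form is what survives the passage to the
  limit.\<close>

lemma positive_bundle_point_bound: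
  assumes "(\<tau>, \<mu>) \<in> fp_bundle F" "\<And>i. 0 < \<mu> $ i"
  shows "\<tau> \<bullet> F \<tau> - F \<tau> $ j \<le> 1 \<bullet> \<mu>"
proof -
  obtain v where \<tau>: "\<tau> \<in> unit_simplex" and \<mu>: "\<mu> = \<tau> * F \<tau> + v *\<^sub>R \<tau>"
    using assms(1) by (auto simp: fp_bundle_eq)
  have "0 < \<tau> $ j * (F \<tau> $ j + v)"
    using assms(2)[of j] by (simp add: \<mu> algebra_simps)
  moreover have "0 \<le> \<tau> $ j"
    using \<tau> by (simp add: mem_unit_simplex_iff)
  ultimately have "0 < F \<tau> $ j + v"
    by (simp add: zero_less_mult_iff)
  moreover have "1 \<bullet> \<mu> = \<tau> \<bullet> F \<tau> + v"
    using \<tau> by (simp add: \<mu> inner_vec_def mem_unit_simplex_iff sum.distrib sum_distrib_left[symmetric])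
  ultimately show ?thesis
    by simp
qed

lemma islimpt_positive_bundle_imp:
  assumes "continuous_on unit_simplex F" "\<sigma> \<in> unit_simplex"
    and "(\<sigma>, 0) islimpt (fp_bundle F \<inter> (unit_simplex \<times> {\<mu>. \<forall>i. 0 < \<mu> $ i}))"
  shows "\<sigma> \<bullet> F \<sigma> \<le> F \<sigma> $ j"
proof -
  obtain p where p: "\<And>n. p n \<in> fp_bundle F \<inter> (unit_simplex \<times> {\<mu>. \<forall>i. 0 < \<mu> $ i})"
    and lim: "p \<longlonglongrightarrow> (\<sigma>, 0)"
    using assms(3) unfolding islimpt_sequential by blast
  have fst: "(\<lambda>n. fst (p n)) \<longlonglongrightarrow> \<sigma>" and snd: "(\<lambda>n. snd (p n)) \<longlonglongrightarrow> 0"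
    using tendsto_fst[OF lim] tendsto_snd[OF lim] by simp_all
  have mem: "fst (p n) \<in> unit_simplex" for n
    using p[of n] by (auto simp: mem_Times_iff)
  have "(\<lambda>n. F (fst (p n))) \<longlonglongrightarrow> F \<sigma>"
    using continuous_on_tendsto_compose[OF assms(1) fst assms(2)] mem by simp
  then have "(\<lambda>n. fst (p n) \<bullet> F (fst (p n)) - F (fst (p n)) $ j) \<longlonglongrightarrow> \<sigma> \<bullet> F \<sigma> - F \<sigma> $ j"
    by (intro tendsto_intros fst)
  moreover have "(\<lambda>n. 1 \<bullet> snd (p n)) \<longlonglongrightarrow> 1 \<bullet> (0 :: real ^ 'a)"
    by (intro tendsto_intros snd)
  moreover have "fst (p n) \<bullet> F (fst (p n)) - F (fst (p n)) $ j \<le> 1 \<bullet> snd (p n)" for n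
    using p[of n] by (intro positive_bundle_point_bound) (auto simp: mem_Times_iff)
  ultimately have "\<sigma> \<bullet> F \<sigma> - F \<sigma> $ j \<le> 1 \<bullet> (0 :: real ^ 'a)"
    using LIMSEQ_le by blast
  then show ?thesis
    by simp
qed

lemma islimpt_positive_bundle:
  fixes F :: "real ^ 'n \<Rightarrow> real ^ 'n"
  assumes cont: "continuous_on unit_simplex F" and \<sigma>: "\<sigma> \<in> unit_simplex"
    and le: "\<And>j. \<sigma> \<bullet> F \<sigma> \<le> F \<sigma> $ j"
  shows "(\<sigma>, 0) islimpt (fp_bundle F \<inter> (unit_simplex \<times> {\<mu>. \<forall>i. 0 < \<mu> $ i}))"
proof -
  define t :: "nat \<Rightarrow> real" where "t k = 1 / real (Suc k)" for k
  \<comment> \<open>All entries of the barycentre are positive, so mixing it in with weight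
    \<open>t k > 0\<close> makes every entry of \<open>\<tau> k\<close> positive.\<close>
  define b :: "real ^ 'n" where "b = (\<chi> i. 1 / real CARD('n))"
  define \<tau> where "\<tau> k = (1 - t k) *\<^sub>R \<sigma> + t k *\<^sub>R b" for k
  \<comment> \<open>The norm absorbs the change of each entry from \<open>F \<sigma>\<close> to
    \<open>F (\<tau> k)\<close>, so \<open>F (\<tau> k) $ i + v k\<close> is at least
    \<open>t k\<close> by the assumed bounds; the summand \<open>t k\<close> secures
    strictness.\<close>
  define v where "v k = t k + norm (F (\<tau> k) - F \<sigma>) - \<sigma> \<bullet> F \<sigma>" for k
  define \<mu> where "\<mu> k = \<tau> k * F (\<tau> k) + v k *\<^sub>R \<tau> k" for k
  have t: "0 < t k" "t k \<le> 1" for k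
    by (auto simp: t_def)
  have t_lim: "t \<longlonglongrightarrow> 0"
    unfolding t_def by (rule LIMSEQ_Suc[OF lim_1_over_n])
  have mem: "\<tau> k \<in> unit_simplex" for k
    using convexD_alt[OF convex_unit_simplex \<sigma> barycentre_in_unit_simplex] t[of k]
    by (simp add: \<tau>_def b_def)
  have \<tau>_pos: "0 < \<tau> k $ i" for k i
    using t[of k] \<sigma> by (simp add: \<tau>_def b_def mem_unit_simplex_iff add_nonneg_pos)
  have "\<tau> \<longlonglongrightarrow> (1 - 0) *\<^sub>R \<sigma> + 0 *\<^sub>R b"
    unfolding \<tau>_def by (intro tendsto_intros t_lim)
  then have \<tau>_lim: "\<tau> \<longlonglongrightarrow> \<sigma>"
    by simp
  have F_lim: "(\<lambda>k. F (\<tau> k)) \<longlonglongrightarrow> F \<sigma>"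
    using continuous_on_tendsto_compose[OF cont \<tau>_lim \<sigma>] mem by simp
  have "v \<longlonglongrightarrow> 0 + norm (F \<sigma> - F \<sigma>) - \<sigma> \<bullet> F \<sigma>"
    unfolding v_def by (intro tendsto_intros t_lim F_lim)
  then have v_lim: "v \<longlonglongrightarrow> - (\<sigma> \<bullet> F \<sigma>)"
    by simp
  have \<mu>_pos: "0 < \<mu> k $ i" for k i
  proof -
    have "\<bar>F (\<tau> k) $ i - F \<sigma> $ i\<bar> \<le> norm (F (\<tau> k) - F \<sigma>)"
      using component_le_norm_cart[of "F (\<tau> k) - F \<sigma>" i] by simp
    then have "0 < F (\<tau> k) $ i + v k"
      using t(1)[of k] le[of i] by (simp add: v_def)
    then have "0 < \<tau> k $ i * (F (\<tau> k) $ i + v k)"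
      using \<tau>_pos by simp
    then show ?thesis
      by (simp add: \<mu>_def algebra_simps)
  qed
  \<comment> \<open>At a solution the minimum of the entries equals
    \<open>\<sigma> \<bullet> F \<sigma>\<close>, so the limit of \<mu> is the nonnegative section,
    which vanishes.\<close>
  have "\<sigma> * F \<sigma> + (- (\<sigma> \<bullet> F \<sigma>)) *\<^sub>R \<sigma> = 0"
  proof -
    have "(MIN i. F \<sigma> $ i) = \<sigma> \<bullet> F \<sigma>"
      using sum_nonneg_section[OF \<sigma>, of F] nonneg_section_eq_0_iff[OF \<sigma>, of F] le by simp
    moreover have "nonneg_section F \<sigma> = 0"
      using nonneg_section_eq_0_iff[OF \<sigma>] le by blast
    ultimately show ?thesis
      by (simp add: nonneg_section_def vec_eq_iff algebra_simps)
  qed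
  moreover have "\<mu> \<longlonglongrightarrow> \<sigma> * F \<sigma> + (- (\<sigma> \<bullet> F \<sigma>)) *\<^sub>R \<sigma>"
  proof (rule vec_tendstoI)
    fix i
    have "(\<lambda>k. \<tau> k $ i * F (\<tau> k) $ i + v k * \<tau> k $ i)
        \<longlonglongrightarrow> \<sigma> $ i * F \<sigma> $ i + (- (\<sigma> \<bullet> F \<sigma>)) * \<sigma> $ i"
      by (intro tendsto_intros \<tau>_lim F_lim v_lim)
    then show "(\<lambda>k. \<mu> k $ i) \<longlonglongrightarrow> (\<sigma> * F \<sigma> + (- (\<sigma> \<bullet> F \<sigma>)) *\<^sub>R \<sigma>) $ i"
      by (simp add: \<mu>_def)
  qed
  ultimately have "(\<lambda>k. (\<tau> k, \<mu> k)) \<longlonglongrightarrow> (\<sigma>, 0)"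
    by (simp add: tendsto_Pair \<tau>_lim)
  \<comment> \<open>Positivity of \<open>\<mu> k\<close> keeps the sequence away from
    \<open>(\<sigma>, 0)\<close>, even where \<open>\<tau> k = \<sigma>\<close>.\<close>
  moreover have "(\<tau> k, \<mu> k) \<in> fp_bundle F \<inter> (unit_simplex \<times> {\<mu>. \<forall>i. 0 < \<mu> $ i}) - {(\<sigma>, 0)}" for k
    using mem \<mu>_pos[of k] by (auto simp: fp_bundle_eq \<mu>_def)
  ultimately show ?thesis
    unfolding islimpt_sequential by (intro exI[of _ "\<lambda>k. (\<tau> k, \<mu> k)"]) blast
qed

theorem theorem6:
  fixes F :: "real ^ 'n \<Rightarrow> real ^ 'n"
  assumes "smooth_map_on F unit_simplex"
  shows "(\<forall>\<sigma>\<in>unit_simplex. \<forall>\<mu>.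
            gap F \<sigma> = 1 \<bullet> nonneg_section F \<sigma> \<and>
            1 \<bullet> nonneg_section F \<sigma> = 1 \<bullet> \<mu> - (MIN i. G_quotient F \<sigma> \<mu> $ i)) \<and>
         (\<forall>\<sigma>\<in>unit_simplex.
            (VI_solution F unit_simplex \<sigma> \<longleftrightarrow> nonneg_section F \<sigma> = 0) \<and>
            (nonneg_section F \<sigma> = 0 \<longleftrightarrow>
               (\<sigma>, 0) islimpt (fp_bundle F \<inter> (unit_simplex \<times> {\<mu>. \<forall>i. 0 < \<mu> $ i}))))"
proof (intro conjI ballI allI)
  fix \<sigma> \<mu> :: "real ^ 'n" assume \<sigma>: "\<sigma> \<in> unit_simplex"
  show "gap F \<sigma> = 1 \<bullet> nonneg_section F \<sigma>"
    by (simp add: gap_eq sum_nonneg_section \<sigma>)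
  \<comment> \<open>The shift of the minimum contains \<open>1 \<bullet> \<mu>\<close>, so \<mu>
    cancels.\<close>
  show "1 \<bullet> nonneg_section F \<sigma> = 1 \<bullet> \<mu> - (MIN i. G_quotient F \<sigma> \<mu> $ i)"
    by (simp add: Min_G_quotient sum_nonneg_section \<sigma>)
next
  fix \<sigma> :: "real ^ 'n" assume \<sigma>: "\<sigma> \<in> unit_simplex"
  show "VI_solution F unit_simplex \<sigma> \<longleftrightarrow> nonneg_section F \<sigma> = 0"
    by (simp add: VI_solution_unit_simplex_iff nonneg_section_eq_0_iff \<sigma>)
  have "continuous_on unit_simplex F"
    using assms by (rule smooth_map_on_imp_continuous_on)
  then show "nonneg_section F \<sigma> = 0 \<longleftrightarrow>
      (\<sigma>, 0) islimpt (fp_bundle F \<inter> (unit_simplex \<times> {\<mu>. \<forall>i. 0 < \<mu> $ i}))"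
    using islimpt_positive_bundle[OF _ \<sigma>] islimpt_positive_bundle_imp[OF _ \<sigma>]
    by (auto simp: nonneg_section_eq_0_iff \<sigma>)
qed

end
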